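(* Let $X$ be a completely regular Hausdorff space. Then $X$ is pseudo-discrete if and only if $I(X)=X_L$ and $C_K(X)$ is a pure ideal of $C(X)$.
   Context: $C(X)$ is the ring of real-valued continuous functions on $X$, and $C_K(X)$ is the ideal of functions $f\in C(X)$ with compact support (the closure in $X$ of $\{x: f(x)\ne 0\}$). $I(X)$ is the set of isolated points of $X$, and $X_L$ is the set of points of $X$ having a compact neighborhood. An ideal $I$ is pure if for every $f\in I$ there is $g\in I$ with $f=fg$. A completely regular space $X$ is pseudo-discrete if every compact subset of $X$ has finite interior. *)

theory Defs
  imports "HOL-Analysis.Analysis" "HOL-Algebra.Ideal"
begin

text \<open>
  Elements of \<open>C(X)\<close> are functions on the whole type that take the value \<^const>\<open>undefined\<close>
  outside \<^term>\<open>topspace X\<close>, so that equality in the ring is equality of functions on \<open>X\<close>.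
\<close>

definition continuous_function_ring :: "'a topology \<Rightarrow> ('a \<Rightarrow> real) ring"
  where "continuous_function_ring X =
    \<lparr> carrier = {f \<in> extensional (topspace X). continuous_map X euclideanreal f},
      mult = (\<lambda>f g. \<lambda>x\<in>topspace X. f x * g x),
      one = (\<lambda>x\<in>topspace X. 1),
      zero = (\<lambda>x\<in>topspace X. 0),
      add = (\<lambda>f g. \<lambda>x\<in>topspace X. f x + g x) \<rparr>"

definition function_support :: "'a topology \<Rightarrow> ('a \<Rightarrow> real) \<Rightarrow> 'a set"
  where "function_support X f = X closure_of {x \<in> topspace X. f x \<noteq> 0}"

definition compact_support_functions :: "'a topology \<Rightarrow> ('a \<Rightarrow> real) set"
  where "compact_support_functions X =
    {f \<in> carrier (continuous_function_ring X). compactin X (function_support X f)}"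

definition pure_ideal :: "'a set \<Rightarrow> ('a, 'b) ring_scheme \<Rightarrow> bool"
  where "pure_ideal I R \<longleftrightarrow> ideal I R \<and> (\<forall>f\<in>I. \<exists>g\<in>I. f = f \<otimes>\<^bsub>R\<^esub> g)"

definition isolated_points :: "'a topology \<Rightarrow> 'a set"
  where "isolated_points X = {x \<in> topspace X. openin X {x}}"

text \<open>A neighborhood of a point is a set containing the point in its interior; it need not be open.\<close>

definition locally_compact_points :: "'a topology \<Rightarrow> 'a set"
  where "locally_compact_points X =
    {x \<in> topspace X. \<exists>K. compactin X K \<and> x \<in> X interior_of K}"

definition pseudo_discrete_space :: "'a topology \<Rightarrow> bool"
  where "pseudo_discrete_space X \<longleftrightarrow>
    completely_regular_space X \<and> (\<forall>K. compactin X K \<longrightarrow> finite (X interior_of K))"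

end

theory Submission
  imports Defs
begin

text \<open>
  Both directions compare compact sets with sets of isolated points. For a continuous \<open>f\<close> the set
  where \<open>f\<close> does not vanish is open, so it lies in the interior of the support of \<open>f\<close>, and for
  \<open>f\<close> in \<open>C\<^sub>K(X)\<close> it consists of points with a compact neighborhood.

  If \<open>X\<close> is pseudo-discrete, the interiors of compact sets are finite, and finite open sets of a
  Hausdorff space consist of isolated points; this gives \<open>I(X) = X\<^sub>L\<close>. Moreover the nonvanishing
  set of any \<open>f\<close> in \<open>C\<^sub>K(X)\<close> is finite and open, hence clopen, and its indicator function is the
  \<open>g\<close> that purity asks for.

  Conversely, suppose that some compact \<open>K\<close> has infinite interior. By \<open>I(X) = X\<^sub>L\<close> this interior
  contains a sequence of distinct isolated points \<open>s n\<close>. The function with value \<open>1 / (n + 1)\<close> at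
  \<open>s n\<close> and zero elsewhere is continuous, because only finitely many of its values exceed a given
  positive bound (lemma \<open>continuous_map_vanishing_on_isolated_points\<close>), and its support lies in
  \<open>K\<close>. Purity provides \<open>g\<close> in \<open>C\<^sub>K(X)\<close> that equals 1 at every \<open>s n\<close>. The set where \<open>g\<close> equals 1
  is closed in the compact support of \<open>g\<close> and consists of isolated points, so it is finite (lemma
  \<open>finite_compact_set_of_isolated_points\<close>), which is absurd.
\<close>

section \<open>The ring of continuous functions and the ideal of compact supports\<close>

lemma carrier_continuous_function_ring_iff:
  "f \<in> carrier (continuous_function_ring X) \<longleftrightarrow>
    f \<in> extensional (topspace X) \<and> continuous_map X euclideanreal f"
  by (simp add: continuous_function_ring_def)

lemma continuous_map_restrict_topspace [simp]:
  "continuous_map X Y (restrict f (topspace X)) \<longleftrightarrow> continuous_map X Y f"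
  by (auto elim: continuous_map_eq)

lemma restrict_in_carrier_continuous_function_ring_iff:
  "restrict f (topspace X) \<in> carrier (continuous_function_ring X) \<longleftrightarrow>
    continuous_map X euclideanreal f"
  by (simp add: carrier_continuous_function_ring_iff)

lemma continuous_function_ring_simps:
  "f \<otimes>\<^bsub>continuous_function_ring X\<^esub> g = (\<lambda>x\<in>topspace X. f x * g x)"
  "f \<oplus>\<^bsub>continuous_function_ring X\<^esub> g = (\<lambda>x\<in>topspace X. f x + g x)"
  "\<one>\<^bsub>continuous_function_ring X\<^esub> = (\<lambda>x\<in>topspace X. 1)"
  "\<zero>\<^bsub>continuous_function_ring X\<^esub> = (\<lambda>x\<in>topspace X. 0)"
  by (simp_all add: continuous_function_ring_def)

lemma ring_continuous_function_ring: "ring (continuous_function_ring X)"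
proof (rule ringI)
  let ?R = "continuous_function_ring X"
  note ring_simps = continuous_function_ring_simps carrier_continuous_function_ring_iff
  show "abelian_group ?R"
  proof (rule abelian_groupI)
    show "f \<oplus>\<^bsub>?R\<^esub> g \<in> carrier ?R" if "f \<in> carrier ?R" "g \<in> carrier ?R" for f g
      using that by (simp add: ring_simps continuous_map_add)
    show "\<zero>\<^bsub>?R\<^esub> \<in> carrier ?R"
      by (simp add: ring_simps)
    show "f \<oplus>\<^bsub>?R\<^esub> g \<oplus>\<^bsub>?R\<^esub> h = f \<oplus>\<^bsub>?R\<^esub> (g \<oplus>\<^bsub>?R\<^esub> h)" for f g h
      by (auto simp: ring_simps)
    show "f \<oplus>\<^bsub>?R\<^esub> g = g \<oplus>\<^bsub>?R\<^esub> f" for f g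
      by (simp add: ring_simps add.commute)
    show "\<zero>\<^bsub>?R\<^esub> \<oplus>\<^bsub>?R\<^esub> f = f" if "f \<in> carrier ?R" for f
      using that by (auto simp: ring_simps extensional_def)
    show "\<exists>g\<in>carrier ?R. g \<oplus>\<^bsub>?R\<^esub> f = \<zero>\<^bsub>?R\<^esub>" if "f \<in> carrier ?R" for f
      using that
      by (intro bexI[of _ "\<lambda>x\<in>topspace X. - f x"])
         (auto simp: ring_simps continuous_map_minus)
  qed
  show "monoid ?R"
  proof (rule monoidI)
    show "f \<otimes>\<^bsub>?R\<^esub> g \<in> carrier ?R" if "f \<in> carrier ?R" "g \<in> carrier ?R" for f g
      using that by (simp add: ring_simps continuous_map_real_mult)
    show "\<one>\<^bsub>?R\<^esub> \<in> carrier ?R"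
      by (simp add: ring_simps)
    show "f \<otimes>\<^bsub>?R\<^esub> g \<otimes>\<^bsub>?R\<^esub> h = f \<otimes>\<^bsub>?R\<^esub> (g \<otimes>\<^bsub>?R\<^esub> h)" for f g h
      by (auto simp: ring_simps)
    show "\<one>\<^bsub>?R\<^esub> \<otimes>\<^bsub>?R\<^esub> f = f" "f \<otimes>\<^bsub>?R\<^esub> \<one>\<^bsub>?R\<^esub> = f" if "f \<in> carrier ?R" for f
      using that by (auto simp: ring_simps extensional_def)
  qed
qed (auto simp: continuous_function_ring_simps algebra_simps)

lemma compactin_function_support_subset:
  assumes "compactin X (function_support X f)"
    and "{x \<in> topspace X. g x \<noteq> 0} \<subseteq> {x \<in> topspace X. f x \<noteq> 0}"
  shows "compactin X (function_support X g)"
proof (rule closed_compactin[OF assms(1)])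
  show "function_support X g \<subseteq> function_support X f"
    unfolding function_support_def using assms(2) by (rule closure_of_mono)
qed (simp add: function_support_def)

lemma compactin_function_support_add:
  assumes "compactin X (function_support X f)" "compactin X (function_support X g)"
  shows "compactin X (function_support X (\<lambda>x\<in>topspace X. f x + g x))"
proof (rule closed_compactin)
  show "compactin X (function_support X f \<union> function_support X g)"
    using assms by (rule compactin_Un)
  show "function_support X (\<lambda>x\<in>topspace X. f x + g x)
      \<subseteq> function_support X f \<union> function_support X g"
    unfolding function_support_def closure_of_Un[symmetric] by (rule closure_of_mono) auto
qed (simp add: function_support_def)

lemma ideal_compact_support_functions:
  "ideal (compact_support_functions X) (continuous_function_ring X)"
proof -
  let ?R = "continuous_function_ring X" and ?I = "compact_support_functions X"
  interpret R: ring ?R by (rule ring_continuous_function_ring)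
  have add_inv: "inv\<^bsub>add_monoid ?R\<^esub> f = (\<lambda>x\<in>topspace X. - f x)" if "f \<in> carrier ?R" for f
  proof -
    have "(\<lambda>x\<in>topspace X. - f x) \<in> carrier ?R"
      using that by (auto simp: restrict_in_carrier_continuous_function_ring_iff
          carrier_continuous_function_ring_iff intro!: continuous_map_minus)
    moreover have "(\<lambda>x\<in>topspace X. - f x) \<oplus>\<^bsub>?R\<^esub> f = \<zero>\<^bsub>?R\<^esub>"
      by (auto simp: continuous_function_ring_simps)
    ultimately show ?thesis
      using that R.minus_equality unfolding a_inv_def by blast
  qed
  show ?thesis
  proof (rule idealI)
    show "ring ?R" by (rule ring_continuous_function_ring)
    show "subgroup ?I (add_monoid ?R)"
    proof (rule group.subgroupI)
      show "group (add_monoid ?R)" by (rule R.a_group)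
      show "?I \<subseteq> carrier (add_monoid ?R)"
        by (auto simp: compact_support_functions_def)
      have "\<zero>\<^bsub>?R\<^esub> \<in> ?I"
        using R.zero_closed
        by (simp add: compact_support_functions_def function_support_def
            continuous_function_ring_simps(4))
      then show "?I \<noteq> {}" by blast
      show "inv\<^bsub>add_monoid ?R\<^esub> f \<in> ?I" if f: "f \<in> ?I" for f
      proof -
        have carrier: "f \<in> carrier ?R" and supp: "compactin X (function_support X f)"
          using f by (auto simp: compact_support_functions_def)
        have "compactin X (function_support X (\<lambda>x\<in>topspace X. - f x))"
          using supp by (rule compactin_function_support_subset) auto
        moreover have "(\<lambda>x\<in>topspace X. - f x) \<in> carrier ?R"
          using carrier by (simp add: carrier_continuous_function_ring_iff continuous_map_minus)
        ultimately show ?thesis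
          unfolding add_inv[OF carrier] compact_support_functions_def by blast
      qed
      show "f \<otimes>\<^bsub>add_monoid ?R\<^esub> g \<in> ?I" if "f \<in> ?I" "g \<in> ?I" for f g
        using that R.a_closed[of f g] compactin_function_support_add[of X f g]
        by (auto simp: compact_support_functions_def continuous_function_ring_simps)
    qed
    show "h \<otimes>\<^bsub>?R\<^esub> f \<in> ?I" "f \<otimes>\<^bsub>?R\<^esub> h \<in> ?I"
      if f: "f \<in> ?I" and h: "h \<in> carrier ?R" for f h
    proof -
      have carrier: "f \<in> carrier ?R" and supp: "compactin X (function_support X f)"
        using f by (auto simp: compact_support_functions_def)
      have "compactin X (function_support X (h \<otimes>\<^bsub>?R\<^esub> f))"
        using supp by (rule compactin_function_support_subset)
          (auto simp: continuous_function_ring_simps)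
      then show "h \<otimes>\<^bsub>?R\<^esub> f \<in> ?I"
        using R.m_closed[OF h carrier] by (simp add: compact_support_functions_def)
      have "compactin X (function_support X (f \<otimes>\<^bsub>?R\<^esub> h))"
        using supp by (rule compactin_function_support_subset)
          (auto simp: continuous_function_ring_simps)
      then show "f \<otimes>\<^bsub>?R\<^esub> h \<in> ?I"
        using R.m_closed[OF carrier h] by (simp add: compact_support_functions_def)
    qed
  qed
qed

section \<open>Isolated points and compact sets\<close>

lemma openin_subset_isolated_points:
  assumes "S \<subseteq> isolated_points X"
  shows "openin X S"
proof (subst openin_subopen, intro ballI)
  fix x assume "x \<in> S"
  then show "\<exists>T. openin X T \<and> x \<in> T \<and> T \<subseteq> S"
    using assms by (intro exI[of _ "{x}"]) (auto simp: isolated_points_def)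
qed

lemma isolated_points_subset_locally_compact_points:
  "isolated_points X \<subseteq> locally_compact_points X"
proof
  fix x assume "x \<in> isolated_points X"
  then have "x \<in> topspace X" "openin X {x}" by (auto simp: isolated_points_def)
  then show "x \<in> locally_compact_points X"
    unfolding locally_compact_points_def
    by (auto intro!: exI[of _ "{x}"] simp: interior_of_openin)
qed

lemma interior_of_compact_subset_locally_compact_points:
  assumes "compactin X K"
  shows "X interior_of K \<subseteq> locally_compact_points X"
  using assms interior_of_subset_topspace[of X K] unfolding locally_compact_points_def by blast

lemma finite_openin_subset_isolated_points:
  assumes "t1_space X" "openin X U" "finite U"
  shows "U \<subseteq> isolated_points X"
proof
  fix x assume x: "x \<in> U"
  \<comment> \<open>Removing the finite, hence closed, set of all other points of \<open>U\<close> leaves an open singleton.\<close>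
  have "closedin X (U - {x})"
    using assms openin_subset[of X U] t1_space_closedin_finite by blast
  then have "openin X (U - (U - {x}))" using assms(2) by blast
  moreover have "U - (U - {x}) = {x}" using x by blast
  ultimately show "x \<in> isolated_points X"
    using x openin_subset[OF assms(2)] by (auto simp: isolated_points_def)
qed

text \<open>The singletons of such a set form an open cover without proper subcovers.\<close>

lemma finite_compact_set_of_isolated_points:
  assumes "compactin X S" "S \<subseteq> isolated_points X"
  shows "finite S"
proof -
  have "\<exists>\<F>. finite \<F> \<and> \<F> \<subseteq> (\<lambda>x. {x}) ` S \<and> S \<subseteq> \<Union>\<F>"
    using assms(2) by (intro compactinD[OF assms(1)]) (auto simp: isolated_points_def)
  then obtain \<F> where "finite \<F>" "\<F> \<subseteq> (\<lambda>x. {x}) ` S" "S \<subseteq> \<Union>\<F>" by blast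
  then show ?thesis by (auto intro!: finite_subset[of S "\<Union>\<F>"])
qed

text \<open>
  A set of reals that misses 0 has a preimage inside the isolated points, where every set is open.
  A neighborhood of 0 has a preimage that omits only finitely many points, and finite sets are
  closed.
\<close>

lemma continuous_map_vanishing_on_isolated_points:
  fixes f :: "'a \<Rightarrow> real"
  assumes "t1_space X"
    and isolated: "\<And>x. x \<in> topspace X \<Longrightarrow> f x \<noteq> 0 \<Longrightarrow> x \<in> isolated_points X"
    and fin: "\<And>e. e > 0 \<Longrightarrow> finite {x \<in> topspace X. \<bar>f x\<bar> \<ge> e}"
  shows "continuous_map X euclideanreal f"
  unfolding continuous_map_def
proof (intro conjI allI impI)
  fix V :: "real set" assume "openin euclideanreal V"
  then have V: "open V" by simp
  show "openin X {x \<in> topspace X. f x \<in> V}"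
  proof (cases "0 \<in> V")
    case True
    then obtain e where e: "e > 0" "\<And>y. \<bar>y\<bar> < e \<Longrightarrow> y \<in> V"
      using V by (metis diff_0_right dist_real_def open_dist)
    have "finite {x \<in> topspace X. f x \<notin> V}"
      by (rule finite_subset[OF _ fin[OF e(1)]]) (use e(2) in force)
    then have "closedin X {x \<in> topspace X. f x \<notin> V}"
      using assms(1) t1_space_closedin_finite by blast
    moreover have "topspace X - {x \<in> topspace X. f x \<notin> V} = {x \<in> topspace X. f x \<in> V}"
      by blast
    ultimately show ?thesis by (metis openin_diff openin_topspace)
  next
    case False
    then show ?thesis by (intro openin_subset_isolated_points) (use isolated in force)
  qed
qed auto

section \<open>Purity and compact sets with finite interior\<close>

lemma openin_nonvanishing_set:
  assumes "f \<in> carrier (continuous_function_ring X)"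
  shows "openin X {x \<in> topspace X. f x \<noteq> 0}"
  using assms openin_continuous_map_preimage[of X euclideanreal f "- {0}"]
  by (simp add: carrier_continuous_function_ring_iff open_Compl)

lemma nonvanishing_set_subset_interior_of_support:
  assumes "f \<in> carrier (continuous_function_ring X)"
  shows "{x \<in> topspace X. f x \<noteq> 0} \<subseteq> X interior_of function_support X f"
  using openin_nonvanishing_set[OF assms] unfolding function_support_def
  by (intro interior_of_maximal closure_of_subset) auto

lemma compact_support_function_equal_1_on_clopen:
  assumes "compactin X S" "openin X S" "closedin X S"
  obtains g where "g \<in> compact_support_functions X"
    and "\<And>x. x \<in> topspace X \<Longrightarrow> g x = (if x \<in> S then 1 else 0)"
proof
  let ?g = "\<lambda>x\<in>topspace X. if x \<in> S then 1 else 0 :: real"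
  have "continuous_map X euclideanreal (\<lambda>x. if x \<in> S then 1 else 0)"
    using frontier_of_eq_empty[OF openin_subset[OF assms(2)]] assms
    by (intro continuous_map_cases) auto
  moreover have "{x \<in> topspace X. ?g x \<noteq> 0} = S"
    using openin_subset[OF assms(2)] by auto
  ultimately show "?g \<in> compact_support_functions X"
    using assms
    by (simp only: compact_support_functions_def function_support_def mem_Collect_eq
        restrict_in_carrier_continuous_function_ring_iff closure_of_closedin simp_thms)
qed auto

text \<open>
  The nonvanishing set \<open>S\<close> of \<open>f\<close> is open, and it is finite because it lies in the interior of a
  compact set. So it is clopen, and \<open>f\<close> is unchanged by multiplication with its indicator function.
\<close>

lemma pure_ideal_if_pseudo_discrete:
  assumes "t1_space X" "pseudo_discrete_space X"
  shows "pure_ideal (compact_support_functions X) (continuous_function_ring X)"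
  unfolding pure_ideal_def
proof (intro conjI ballI ideal_compact_support_functions)
  fix f assume f: "f \<in> compact_support_functions X"
  define S where "S = {x \<in> topspace X. f x \<noteq> 0}"
  have carrier: "f \<in> carrier (continuous_function_ring X)"
    using f by (simp add: compact_support_functions_def)
  have "finite (X interior_of function_support X f)"
    using f assms(2) by (auto simp: compact_support_functions_def pseudo_discrete_space_def)
  then have S: "finite S" "S \<subseteq> topspace X"
    using nonvanishing_set_subset_interior_of_support[OF carrier] finite_subset
    by (auto simp: S_def)
  moreover have "openin X S" using openin_nonvanishing_set[OF carrier] by (simp add: S_def)
  moreover have "closedin X S" using S assms(1) t1_space_closedin_finite by blast
  ultimately obtain g where g: "g \<in> compact_support_functions X"
      "\<And>x. x \<in> topspace X \<Longrightarrow> g x = (if x \<in> S then 1 else 0)"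
    using compact_support_function_equal_1_on_clopen[of X S] finite_imp_compactin by metis
  have "f x = (f \<otimes>\<^bsub>continuous_function_ring X\<^esub> g) x" for x
    using carrier g(2)[of x]
    by (auto simp: continuous_function_ring_simps carrier_continuous_function_ring_iff
        S_def extensional_def)
  then show "\<exists>g\<in>compact_support_functions X. f = f \<otimes>\<^bsub>continuous_function_ring X\<^esub> g"
    using g(1) by blast
qed

lemma isolated_points_eq_locally_compact_points_if_pseudo_discrete:
  assumes "t1_space X" "pseudo_discrete_space X"
  shows "isolated_points X = locally_compact_points X"
proof
  show "locally_compact_points X \<subseteq> isolated_points X"
  proof
    fix x assume "x \<in> locally_compact_points X"
    then obtain K where K: "compactin X K" "x \<in> X interior_of K"
      by (auto simp: locally_compact_points_def)
    then have "finite (X interior_of K)"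
      using assms(2) by (simp add: pseudo_discrete_space_def)
    then show "x \<in> isolated_points X"
      using K finite_openin_subset_isolated_points[OF assms(1) openin_interior_of] by blast
  qed
qed (rule isolated_points_subset_locally_compact_points)

text \<open>
  A level set of \<open>g\<close> at a nonzero value is closed, hence compact inside the support of \<open>g\<close>, and it
  lies in the open set where \<open>g\<close> does not vanish, which here consists of isolated points.
\<close>

lemma finite_level_set_of_compact_support_function:
  assumes "isolated_points X = locally_compact_points X"
    and g: "g \<in> compact_support_functions X" and "c \<noteq> 0"
  shows "finite {x \<in> topspace X. g x = c}"
proof (rule finite_compact_set_of_isolated_points)
  let ?S = "{x \<in> topspace X. g x = c}"
  have carrier: "g \<in> carrier (continuous_function_ring X)"
    and compact: "compactin X (function_support X g)"
    using g by (auto simp: compact_support_functions_def)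
  have sub: "?S \<subseteq> X interior_of function_support X g"
    using nonvanishing_set_subset_interior_of_support[OF carrier] \<open>c \<noteq> 0\<close> by blast
  then show "?S \<subseteq> isolated_points X"
    using interior_of_compact_subset_locally_compact_points[OF compact] assms(1) by blast
  have "closedin X {x \<in> topspace X. g x \<in> {c}}"
    using carrier by (intro closedin_continuous_map_preimage)
      (auto simp: carrier_continuous_function_ring_iff)
  then have "closedin X ?S" by simp
  moreover have "?S \<subseteq> function_support X g"
    using sub interior_of_subset[of X "function_support X g"] by blast
  ultimately show "compactin X ?S"
    using closed_compactin[OF compact] by blast
qed

text \<open>
  This is the test function for purity: any \<open>g\<close> with \<open>f = f g\<close> must equal 1 on the whole sequence.
  The values of \<open>f\<close> have to tend to 0 along the sequence: it may accumulate at points of \<open>K\<close>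
  outside its range, where \<open>f\<close> vanishes.
\<close>

lemma compact_support_function_positive_on_isolated_sequence:
  fixes s :: "nat \<Rightarrow> 'a"
  assumes "Hausdorff_space X" "compactin X K" "inj s"
    and s: "range s \<subseteq> isolated_points X" "range s \<subseteq> K"
  obtains f where "f \<in> compact_support_functions X" "\<And>n. f (s n) > 0"
proof
  define h :: "'a \<Rightarrow> real"
    where "h x = (if x \<in> range s then 1 / (real (inv_into UNIV s x) + 1) else 0)" for x
  have h_s: "h (s n) = 1 / (real n + 1)" for n
    using \<open>inj s\<close> by (simp add: h_def)
  have h_nonzero: "x \<in> range s" if "h x \<noteq> 0" for x
    using that by (auto simp: h_def split: if_splits)
  have s_top: "s n \<in> topspace X" for n
    using s(1) by (auto simp: isolated_points_def)
  have "continuous_map X euclideanreal h"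
  proof (rule continuous_map_vanishing_on_isolated_points)
    show "t1_space X" using assms(1) by (rule Hausdorff_imp_t1_space)
    show "x \<in> isolated_points X" if "h x \<noteq> 0" for x
      using h_nonzero[OF that] s(1) by blast
    fix e :: real assume "e > 0"
    have "{x \<in> topspace X. \<bar>h x\<bar> \<ge> e} \<subseteq> s ` {..nat \<lceil>1 / e\<rceil>}"
    proof
      fix x assume "x \<in> {x \<in> topspace X. \<bar>h x\<bar> \<ge> e}"
      then have x: "\<bar>h x\<bar> \<ge> e" by simp
      then have "h x \<noteq> 0" using \<open>e > 0\<close> by auto
      then obtain n where n: "x = s n" using h_nonzero by blast
      then have "e \<le> 1 / (real n + 1)" using x h_s by simp
      then have "real n + 1 \<le> 1 / e" using \<open>e > 0\<close> by (simp add: field_simps)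
      then have "n \<le> nat \<lceil>1 / e\<rceil>" by linarith
      then show "x \<in> s ` {..nat \<lceil>1 / e\<rceil>}" using n by blast
    qed
    then show "finite {x \<in> topspace X. \<bar>h x\<bar> \<ge> e}" by (rule finite_subset) simp
  qed
  moreover have "compactin X (function_support X (restrict h (topspace X)))"
  proof (rule closed_compactin[OF assms(2)])
    have "{x \<in> topspace X. restrict h (topspace X) x \<noteq> 0} \<subseteq> K"
      using h_nonzero s(2) by auto
    then show "function_support X (restrict h (topspace X)) \<subseteq> K"
      unfolding function_support_def
      using assms(1,2) by (intro closure_of_minimal compactin_imp_closedin)
  qed (simp add: function_support_def)
  ultimately show "restrict h (topspace X) \<in> compact_support_functions X"
    by (simp add: compact_support_functions_def restrict_in_carrier_continuous_function_ring_iff)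
  show "restrict h (topspace X) (s n) > 0" for n
    using s_top by (simp add: h_s)
qed

lemma finite_interior_of_compact_if_pure:
  assumes "Hausdorff_space X" and eq: "isolated_points X = locally_compact_points X"
    and pure: "pure_ideal (compact_support_functions X) (continuous_function_ring X)"
    and K: "compactin X K"
  shows "finite (X interior_of K)"
proof (rule ccontr)
  assume "infinite (X interior_of K)"
  then obtain s :: "nat \<Rightarrow> 'a" where s: "inj s" "range s \<subseteq> X interior_of K"
    using infinite_countable_subset by blast
  have "range s \<subseteq> isolated_points X"
    using s(2) interior_of_compact_subset_locally_compact_points[OF K] eq by blast
  moreover have "range s \<subseteq> K" using s(2) interior_of_subset[of X K] by blast
  ultimately obtain f where f: "f \<in> compact_support_functions X" "\<And>n. f (s n) > 0"
    using compact_support_function_positive_on_isolated_sequence[OF assms(1) K s(1)] by metis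
  then obtain g where g: "g \<in> compact_support_functions X"
      "f = f \<otimes>\<^bsub>continuous_function_ring X\<^esub> g"
    using pure unfolding pure_ideal_def by blast
  have s_top: "s n \<in> topspace X" for n
    using s(2) interior_of_subset_topspace[of X K] by blast
  have "g (s n) = 1" for n
  proof -
    have "f (s n) = f (s n) * g (s n)"
      using fun_cong[OF g(2), of "s n"] s_top by (simp add: continuous_function_ring_simps)
    then show ?thesis using f(2)[of n] by simp
  qed
  then have "range s \<subseteq> {x \<in> topspace X. g x = 1}" using s_top by auto
  then have "finite (range s)"
    using finite_level_set_of_compact_support_function[OF eq g(1), of 1] finite_subset by auto
  then show False using s(1) finite_imageD by blast
qed

theorem corollary3p7:
  fixes X :: "'a topology"
  assumes "completely_regular_space X" and "Hausdorff_space X"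
  shows "pseudo_discrete_space X \<longleftrightarrow>
    isolated_points X = locally_compact_points X \<and>
    pure_ideal (compact_support_functions X) (continuous_function_ring X)"
proof
  have t1: "t1_space X" using assms(2) by (rule Hausdorff_imp_t1_space)
  assume "pseudo_discrete_space X"
  then show "isolated_points X = locally_compact_points X \<and>
      pure_ideal (compact_support_functions X) (continuous_function_ring X)"
    using isolated_points_eq_locally_compact_points_if_pseudo_discrete[OF t1]
      pure_ideal_if_pseudo_discrete[OF t1] by simp
next
  assume "isolated_points X = locally_compact_points X \<and>
      pure_ideal (compact_support_functions X) (continuous_function_ring X)"
  then show "pseudo_discrete_space X"
    using assms finite_interior_of_compact_if_pure[of X]
    by (simp add: pseudo_discrete_space_def)
qed

end
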